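(* There exist constants $C_1(d),C_2(\mathscr L,d)>0$ such that, for every $\Gamma\ge2$, any $\Gamma$-chain $(j_q)_{q=0,\dots,L}\subset\mathbb Z^d$ has length at most $$L\le C_2(\mathscr L,d)\,\Gamma^{C_1(d)} .$$
   Context: $\mathscr L=\{\sum_{i=1}^d m_i\mathbf v_i: m_i\in\mathbb Z\}$ is an arbitrary lattice of $\mathbb R^d$ with linearly independent generators $\mathbf v_1,\dots,\mathbf v_d$; $\mathbf V=(\mathbf v_1|\cdots|\mathbf v_d)$, $W=\mathbf V^{-\top}$, and $\mu_j=\|Wj\|^2$ for $j\in\mathbb Z^d$ ($\|\cdot\|$ Euclidean). Define $\Phi(j)=(j,\mu_j)\in\mathbb Z^d\times\mathbb R$, and let $|\cdot|$ be the max norm. Given $\Gamma\ge2$, a $\Gamma$-chain is a sequence of distinct integer vectors $(j_q)_{q=0,\dots,L}\subset\mathbb Z^d$ such that $|\Phi(j_{q+1})-\Phi(j_q)|\le\Gamma$ for all $0\le q\le L-1$; $L$ is called the length of the chain. The constants depend only on the indicated quantities (in particular not on $\Gamma$ nor on the chain). *)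

theory Defs
  imports "HOL-Analysis.Analysis"
begin

text \<open>
  The dimension is \<open>d = CARD('n)\<close>. A lattice is given by a family \<open>v\<close> of generators indexed by \<open>'n\<close>;
  the eigenvalues and the chains below depend on the lattice through these chosen generators.
\<close>

definition lattice_generators :: "('n \<Rightarrow> real ^ 'n) \<Rightarrow> bool" where
  "lattice_generators v \<longleftrightarrow> inj v \<and> independent (range v)"

definition gen_matrix :: "('n \<Rightarrow> real ^ 'n) \<Rightarrow> real ^ 'n ^ 'n" where
  "gen_matrix v = (\<chi> i k. v k $ i)"

definition dual_matrix :: "('n \<Rightarrow> real ^ 'n) \<Rightarrow> real ^ 'n ^ 'n" where
  "dual_matrix v = transpose (matrix_inv (gen_matrix v))"

definition real_vec :: "int ^ 'n \<Rightarrow> real ^ 'n" where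
  "real_vec j = (\<chi> i. real_of_int (j $ i))"

definition \<mu> :: "('n \<Rightarrow> real ^ 'n) \<Rightarrow> int ^ 'n \<Rightarrow> real" where
  "\<mu> v j = (norm (dual_matrix v *v real_vec j))\<^sup>2"

definition \<Phi> :: "('n \<Rightarrow> real ^ 'n) \<Rightarrow> int ^ 'n \<Rightarrow> (real ^ 'n) \<times> real" where
  "\<Phi> v j = (real_vec j, \<mu> v j)"

text \<open>
  On the Euclidean space \<open>(real ^ 'n) \<times> real\<close>, \<^const>\<open>infnorm\<close> is the maximum of the absolute values
  of all \<open>d + 1\<close> coordinates. Only the values \<open>j 0, \<dots>, j L\<close> of the function \<open>j\<close> belong to the chain.
\<close>

definition gamma_chain :: "('n \<Rightarrow> real ^ 'n) \<Rightarrow> real \<Rightarrow> nat \<Rightarrow> (nat \<Rightarrow> int ^ 'n) \<Rightarrow> bool" where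
  "gamma_chain v \<Gamma> L j \<longleftrightarrow>
     inj_on j {0..L} \<and> (\<forall>q<L. infnorm (\<Phi> v (j (Suc q)) - \<Phi> v (j q)) \<le> \<Gamma>)"

end

theory Submission
  imports Defs
begin

text \<open>
  Induct on the dimension \<open>g\<close> of the affine hull of a chain. If \<open>m\<close> exceeds the bound for dimension
  \<open>g\<close>, then in a chain of dimension \<open>g + 1\<close> every window of length \<open>m\<close> already spans the whole
  direction space \<open>G\<close>. For each member \<open>j\<^sub>q\<close> this gives integer vectors \<open>f\<close> spanning \<open>G\<close>, of size at most
  \<open>m \<Gamma>\<close>, and polarizing \<open>\<mu>\<close> gives \<open>\<bar>W j\<^sub>q \<bullet> W f\<bar> = O((m \<Gamma>)\<^sup>2)\<close>. A nonzero integer determinant is at least 1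
  in absolute value, so by Cramer's rule the functional \<open>W j\<^sub>q \<bullet> W z\<close> is at most polynomial in \<open>m \<Gamma>\<close>
  times \<open>\<parallel>z\<parallel>\<close> on \<open>G\<close>. For \<open>z = j\<^sub>q - j\<^sub>0\<close> the identity \<open>\<parallel>W z\<parallel>\<^sup>2 = W j\<^sub>q \<bullet> W z - W j\<^sub>0 \<bullet> W z\<close> then confines the
  chain to a box of polynomial size, which contains polynomially many integer points.
\<close>

section \<open>Determinants and Cramer's rule over the integers\<close>

text \<open>Each of the \<open>fact CARD('n)\<close> Leibniz terms takes exactly one entry from
  every column. The bound varies with the column because Cramer's rule replaces a single column by
  the right-hand side.\<close>

lemma abs_det_le_fact_prod:
  fixes A :: "real^'n^'n"
  assumes "\<And>i k. \<bar>A $ i $ k\<bar> \<le> m k"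
  shows "\<bar>det A\<bar> \<le> fact CARD('n) * (\<Prod>k\<in>UNIV. m k)"
proof -
  have "\<bar>of_int (sign p) * (\<Prod>i\<in>UNIV. A $ i $ p i)\<bar> \<le> (\<Prod>k\<in>UNIV. m k)"
    if p: "p permutes (UNIV :: 'n set)" for p
  proof -
    have "\<bar>of_int (sign p) * (\<Prod>i\<in>UNIV. A $ i $ p i)\<bar> = (\<Prod>i\<in>UNIV. \<bar>A $ i $ p i\<bar>)"
      by (simp add: abs_mult abs_prod flip: of_int_abs)
    also have "\<dots> \<le> (\<Prod>i\<in>UNIV. m (p i))"
      by (intro prod_mono conjI assms) auto
    also have "\<dots> = (\<Prod>k\<in>UNIV. m k)"
      using prod.permute[OF p, of m] by (simp add: comp_def)
    finally show ?thesis .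
  qed
  then have "\<bar>det A\<bar> \<le> (\<Sum>p | p permutes (UNIV :: 'n set). \<Prod>k\<in>UNIV. m k)"
    unfolding det_def by (intro order.trans[OF sum_abs] sum_mono) auto
  then show ?thesis
    by (simp add: card_permutations)
qed

lemma Ints_det:
  fixes A :: "real^'n^'n"
  assumes "\<And>i k. A $ i $ k \<in> \<int>"
  shows "det A \<in> \<int>"
  unfolding det_def using assms by (intro Ints_sum Ints_mult Ints_prod) auto

text \<open>In Cramer's rule the denominator is a nonzero integer, hence at least 1 in absolute
  value, and the numerator has one column bounded by \<open>norm z\<close> and all others by
  \<open>M\<close>. Only the matrix has to be integral; \<open>z\<close> is any real vector.\<close>

lemma solution_component_le:
  fixes A :: "real^'n^'n"
  assumes "\<And>i k. A $ i $ k \<in> \<int>" and M: "\<And>i k. \<bar>A $ i $ k\<bar> \<le> M" and "M \<ge> 1"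
    and "det A \<noteq> 0" and "A *v c = z"
  shows "\<bar>c $ k\<bar> \<le> fact CARD('n) * M ^ CARD('n) * norm z"
proof -
  have "\<bar>det A\<bar> \<ge> 1"
    using Ints_nonzero_abs_ge1[OF Ints_det] assms by blast
  let ?D = "(\<chi> i l. if l = k then z $ i else A $ i $ l) :: real^'n^'n"
  have "\<bar>det ?D\<bar> \<le> fact CARD('n) * (\<Prod>l\<in>UNIV. if l = k then norm z else M)"
    by (rule abs_det_le_fact_prod) (use M component_le_norm_cart in auto)
  also have "(\<Prod>l\<in>UNIV. if l = k then norm z else M) = norm z * M ^ (CARD('n) - 1)"
    by (subst prod.remove[of _ k]) (auto simp: card_Diff_singleton)
  also have "\<dots> \<le> norm z * M ^ CARD('n)"
    using \<open>M \<ge> 1\<close> by (intro mult_left_mono power_increasing) auto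
  finally have D: "\<bar>det ?D\<bar> \<le> fact CARD('n) * M ^ CARD('n) * norm z"
    by (simp add: mult_ac)
  have "c $ k = det ?D / det A"
    using iffD1[OF cramer[OF \<open>det A \<noteq> 0\<close>] \<open>A *v c = z\<close>] by simp
  then have "\<bar>c $ k\<bar> = \<bar>det ?D\<bar> / \<bar>det A\<bar>"
    by simp
  also have "\<dots> \<le> \<bar>det ?D\<bar> / 1"
    using \<open>\<bar>det A\<bar> \<ge> 1\<close> by (intro divide_left_mono) auto
  finally show ?thesis
    using D by simp
qed

text \<open>\<open>F\<close> may span a proper subspace, so a basis chosen from \<open>F\<close> is
  first completed to a square system. The components of \<open>z\<close> are then bounded by
  Cramer's rule, and linearity of \<open>\<phi>\<close> does the rest.\<close>

lemma abs_linear_on_span_le: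
  fixes F :: "(real^'n) set" and \<phi> :: "real^'n \<Rightarrow> real" and M T :: real
  assumes int: "\<And>f i. f \<in> F \<Longrightarrow> f $ i \<in> \<int>"
    and M: "\<And>f i. f \<in> F \<Longrightarrow> \<bar>f $ i\<bar> \<le> M" and "M \<ge> 1"
    and "linear \<phi>" and T: "\<And>f. f \<in> F \<Longrightarrow> \<bar>\<phi> f\<bar> \<le> T" and "T \<ge> 0"
    and "z \<in> span F"
  shows "\<bar>\<phi> z\<bar> \<le> real CARD('n) * fact CARD('n) * M ^ CARD('n) * norm z * T"
proof -
  obtain B0 where B0: "B0 \<subseteq> F" "independent B0" "F \<subseteq> span B0"
    using maximal_independent_subset by blast
  \<comment> \<open>Completing with standard basis vectors keeps all entries integral and, as
    \<open>M \<ge> 1\<close>, bounded by \<open>M\<close>.\<close>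
  obtain B where B: "B0 \<subseteq> B" "B \<subseteq> B0 \<union> Basis" "independent B" "B0 \<union> Basis \<subseteq> span B"
    using maximal_independent_subset_extend[of B0 "B0 \<union> Basis"] B0 by blast
  have spanB: "span B = UNIV"
    by (metis B(4) Un_subset_iff span_Basis span_minimal subspace_span top.extremum_uniqueI)
  have "finite B"
    using B(3) by (simp add: finiteI_independent)
  have "card B = CARD('n)"
    using basis_card_eq_dim[of B UNIV] B(3) spanB by simp
  then obtain h :: "'n \<Rightarrow> real^'n" where h: "bij_betw h UNIV B"
    using finite_same_card_bij[of "UNIV :: 'n set" B] \<open>finite B\<close> by auto
  define A where "A = (\<chi> i k. h k $ i)"
  have col: "column k A = h k" for k
    by (simp add: A_def column_def vec_eq_iff)
  have "columns A = B"
    using h by (auto simp: columns_def col bij_betw_def)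
  then have "\<exists>A'. A ** A' = mat 1"
    using spanB by (simp add: matrix_right_invertible_span_columns span_vec_eq)
  then have det: "det A \<noteq> 0"
    by (simp add: invertible_det_nz flip: invertible_right_inverse)
  have hB: "h k \<in> B0 \<union> Basis" for k
    using h B(2) by (auto simp: bij_betw_def)
  have Aint: "A $ i $ k \<in> \<int>" for i k
    using hB[of k] int B0(1) by (auto simp: A_def Basis_vec_def axis_def)
  have AM: "\<bar>A $ i $ k\<bar> \<le> M" for i k
    using hB[of k] M B0(1) \<open>M \<ge> 1\<close> by (auto simp: A_def Basis_vec_def axis_def)
  have "z \<in> span B0"
    using \<open>z \<in> span F\<close> B0(3) by (metis span_minimal subspace_span subsetD)
  then obtain r where r: "z = (\<Sum>b\<in>B0. r b *\<^sub>R b)"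
    using span_finite[of B0] B(1) \<open>finite B\<close> finite_subset by (metis (no_types, lifting) image_iff)
  \<comment> \<open>Coefficients on the added vectors vanish, so a bound for \<open>\<phi>\<close>
    is needed only on \<open>B0\<close>, a subset of \<open>F\<close>.\<close>
  define c where "c = (\<chi> k. if h k \<in> B0 then r (h k) else 0)"
  have zc: "z = (\<Sum>k\<in>UNIV. (c $ k) *\<^sub>R h k)"
  proof -
    have "z = (\<Sum>b\<in>B. (if b \<in> B0 then r b else 0) *\<^sub>R b)"
      unfolding r using B(1) \<open>finite B\<close> by (intro sum.mono_neutral_cong_left) auto
    also have "\<dots> = (\<Sum>k\<in>UNIV. (c $ k) *\<^sub>R h k)"
      unfolding c_def by (subst sum.reindex_bij_betw[OF h, symmetric]) simp
    finally show ?thesis .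
  qed
  then have Ac: "A *v c = z"
    by (simp add: matrix_mult_sum col scalar_mult_eq_scaleR)
  have "\<bar>\<phi> z\<bar> = \<bar>\<Sum>k\<in>UNIV. c $ k * \<phi> (h k)\<bar>"
    by (subst zc) (simp add: linear_sum[OF \<open>linear \<phi>\<close>] linear_cmul[OF \<open>linear \<phi>\<close>])
  also have "\<dots> \<le> (\<Sum>k\<in>(UNIV :: 'n set). fact CARD('n) * M ^ CARD('n) * norm z * T)"
  proof (intro order.trans[OF sum_abs] sum_mono)
    fix k
    show "\<bar>c $ k * \<phi> (h k)\<bar> \<le> fact CARD('n) * M ^ CARD('n) * norm z * T"
    proof (cases "h k \<in> B0")
      case True
      then have "\<bar>\<phi> (h k)\<bar> \<le> T"
        using T B0(1) by blast
      then show ?thesis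
        unfolding abs_mult
        using solution_component_le[OF Aint AM \<open>M \<ge> 1\<close> det Ac] \<open>M \<ge> 1\<close> by (intro mult_mono) auto
    next
      case False
      then show ?thesis
        using \<open>M \<ge> 1\<close> \<open>T \<ge> 0\<close> by (simp add: c_def)
    qed
  qed
  finally show ?thesis
    by (simp add: mult_ac)
qed

section \<open>The dual map and increments along a chain\<close>

abbreviation dual_map :: "('n \<Rightarrow> real^'n) \<Rightarrow> real^'n \<Rightarrow> real^'n" where
  "dual_map v x \<equiv> dual_matrix v *v x"

text \<open>As many independent columns as the dimension span the space, so the generator matrix is
  invertible, and with it its inverse transpose. Injectivity later supplies a lower bound
  \<open>c * norm x \<le> norm (dual_map v x)\<close> with \<open>c > 0\<close>.\<close>

lemma inj_dual_map:
  assumes "lattice_generators (v :: 'n::finite \<Rightarrow> real^'n)"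
  shows "inj (dual_map v)"
proof -
  have "column k (gen_matrix v) = v k" for k
    by (simp add: gen_matrix_def column_def vec_eq_iff)
  then have columns: "columns (gen_matrix v) = range v"
    by (auto simp: columns_def)
  have "card (range v) = CARD('n)"
    using assms by (simp add: lattice_generators_def card_image)
  then have "dim (span (range v)) = dim (UNIV :: (real^'n) set)"
    using assms by (simp add: lattice_generators_def dim_eq_card_independent)
  then have "span (range v) = UNIV"
    by (intro subspace_dim_equal) auto
  then have "\<exists>A'. gen_matrix v ** A' = mat 1"
    by (simp add: matrix_right_invertible_span_columns span_vec_eq columns)
  then have "invertible (gen_matrix v)"
    by (simp flip: invertible_right_inverse)
  then have "gen_matrix v ** matrix_inv (gen_matrix v) = mat 1"
    unfolding invertible_def matrix_inv_def by (rule someI2_ex) simp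
  then have "transpose (matrix_inv (gen_matrix v)) ** transpose (gen_matrix v) = mat 1"
    by (metis matrix_transpose_mul transpose_mat)
  then have "invertible (dual_matrix v)"
    unfolding dual_matrix_def using invertible_right_inverse by blast
  then show ?thesis
    by (simp add: inj_matrix_vector_mult)
qed

lemma abs_diff_le_of_steps:
  fixes x :: "nat \<Rightarrow> real"
  assumes "\<And>q. q < L \<Longrightarrow> \<bar>x (Suc q) - x q\<bar> \<le> \<Gamma>" and "p \<le> L" and "q \<le> L"
  shows "\<bar>x p - x q\<bar> \<le> \<bar>real p - real q\<bar> * \<Gamma>"
proof -
  have *: "\<bar>x (k + n) - x k\<bar> \<le> real n * \<Gamma>" if "k + n \<le> L" for k n
    using that
  proof (induction n)
    case (Suc n)
    have "\<bar>x (k + n) - x k\<bar> \<le> real n * \<Gamma>" "\<bar>x (Suc (k + n)) - x (k + n)\<bar> \<le> \<Gamma>"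
      using Suc assms(1)[of "k + n"] by auto
    then show ?case
      by (simp add: algebra_simps)
  qed simp
  show ?thesis
  proof (cases "p \<le> q")
    case True
    then show ?thesis
      using *[of p "q - p"] assms by (simp add: of_nat_diff abs_minus_commute)
  next
    case False
    then show ?thesis
      using *[of q "p - q"] assms by (simp add: of_nat_diff)
  qed
qed

lemma gamma_chain_subchain:
  assumes "gamma_chain v \<Gamma> L j" and "a + m \<le> L"
  shows "gamma_chain v \<Gamma> m (\<lambda>p. j (a + p))"
proof -
  have "inj_on (j \<circ> (+) a) {0..m}"
    using assms by (intro comp_inj_on) (auto simp: gamma_chain_def intro: inj_on_subset)
  then show ?thesis
    using assms by (auto simp: gamma_chain_def comp_def)
qed

lemma gamma_chain_diff_le:
  assumes "gamma_chain v \<Gamma> L j" and "p \<le> L" and "q \<le> L"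
  shows "\<bar>(real_vec (j p) - real_vec (j q)) $ i\<bar> \<le> \<bar>real p - real q\<bar> * \<Gamma>"
    and "\<bar>\<mu> v (j p) - \<mu> v (j q)\<bar> \<le> \<bar>real p - real q\<bar> * \<Gamma>"
proof -
  have step: "infnorm (\<Phi> v (j (Suc q)) - \<Phi> v (j q)) \<le> \<Gamma>" if "q < L" for q
    using assms(1) that by (auto simp: gamma_chain_def)
  \<comment> \<open>Pairing with \<open>(axis i 1, 0)\<close> extracts a lattice coordinate of
    \<open>\<Phi>\<close>; pairing with \<open>(0, 1)\<close> below extracts
    \<open>\<mu>\<close>.\<close>
  have "\<bar>real_vec (j (Suc q)) $ i - real_vec (j q) $ i\<bar> \<le> \<Gamma>" if "q < L" for q
    using order.trans[OF Basis_le_infnorm[of "(axis i 1, 0)"] step[OF that]]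
    by (auto simp: Basis_prod_def Basis_vec_def \<Phi>_def inner_axis)
  then show "\<bar>(real_vec (j p) - real_vec (j q)) $ i\<bar> \<le> \<bar>real p - real q\<bar> * \<Gamma>"
    using abs_diff_le_of_steps[of L "\<lambda>q. real_vec (j q) $ i"] assms by simp
  have "\<bar>\<mu> v (j (Suc q)) - \<mu> v (j q)\<bar> \<le> \<Gamma>" if "q < L" for q
    using order.trans[OF Basis_le_infnorm[of "(0, 1)"] step[OF that]]
    by (simp add: Basis_prod_def \<Phi>_def)
  then show "\<bar>\<mu> v (j p) - \<mu> v (j q)\<bar> \<le> \<bar>real p - real q\<bar> * \<Gamma>"
    using abs_diff_le_of_steps[of L "\<lambda>q. \<mu> v (j q)"] assms by simp
qed

text \<open>Polarization bounds the functional on the differences \<open>f\<close> from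
  \<open>j q\<close>, since both the increment of \<open>\<mu>\<close> and
  \<open>norm (dual_map v f)\<close> are controlled; \<open>abs_linear_on_span_le\<close> extends
  this to their span. In the exponent, \<open>CARD('n)\<close> comes from Cramer's rule and 2 from
  the quadratic term.\<close>

lemma chain_inner_le:
  fixes v :: "'n::finite \<Rightarrow> real^'n"
    and \<Gamma> m K :: real
  defines "F \<equiv> \<lambda>q P j. (\<lambda>p. real_vec (j p) - real_vec (j q)) ` P"
  assumes chain: "gamma_chain v \<Gamma> L j" and "q \<le> L" and P: "\<And>p. p \<in> P \<Longrightarrow> p \<le> L \<and> \<bar>real p - real q\<bar> \<le> m"
    and m: "m * \<Gamma> \<ge> 1" and "\<Gamma> \<ge> 0"
    and K: "\<And>x. norm (dual_map v x) \<le> K * norm x"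
    and z: "z \<in> span (F q P j)"
  shows "\<bar>dual_map v (real_vec (j q)) \<bullet> dual_map v z\<bar>
    \<le> real CARD('n) * fact CARD('n) * (1 + (K * CARD('n))\<^sup>2) * (m * \<Gamma>) ^ (CARD('n) + 2) * norm z"
proof -
  let ?x = "real_vec (j q)" and ?n = "real CARD('n)" and ?T = "(1 + (K * CARD('n))\<^sup>2) * (m * \<Gamma>)\<^sup>2"
  have F: "\<bar>f $ i\<bar> \<le> m * \<Gamma>" if "f \<in> F q P j" for f i
  proof -
    obtain p where p: "p \<in> P" "f = real_vec (j p) - ?x"
      using \<open>f \<in> F q P j\<close> by (auto simp: F_def)
    have "\<bar>f $ i\<bar> \<le> \<bar>real p - real q\<bar> * \<Gamma>"
      using gamma_chain_diff_le(1)[OF chain _ \<open>q \<le> L\<close>] P[OF p(1)] p(2) by blast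
    also have "\<dots> \<le> m * \<Gamma>"
      using P[OF p(1)] \<open>\<Gamma> \<ge> 0\<close> by (intro mult_right_mono) auto
    finally show ?thesis .
  qed
  have "\<bar>dual_map v ?x \<bullet> dual_map v z\<bar> \<le> real CARD('n) * fact CARD('n) * (m * \<Gamma>) ^ CARD('n) * norm z * ?T"
  proof (rule abs_linear_on_span_le[where F = "F q P j"])
    show "f $ i \<in> \<int>" if "f \<in> F q P j" for f i
      using that by (auto simp: F_def real_vec_def)
    show "\<bar>f $ i\<bar> \<le> m * \<Gamma>" if "f \<in> F q P j" for f i
      using F that .
    show "linear (\<lambda>y. dual_map v ?x \<bullet> dual_map v y)"
      by (intro linearI) (simp_all add: matrix_vector_right_distrib inner_add_right matrix_vector_mult_scaleR)
    show "\<bar>dual_map v ?x \<bullet> dual_map v f\<bar> \<le> ?T" if f: "f \<in> F q P j" for f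
    proof -
      obtain p where p: "p \<in> P" "f = real_vec (j p) - ?x"
        using f by (auto simp: F_def)
      have "norm f \<le> (\<Sum>i\<in>(UNIV :: 'n set). m * \<Gamma>)"
        using F[OF f] by (intro order.trans[OF norm_le_l1_cart] sum_mono)
      then have "norm (dual_map v f) \<le> K * norm f" "norm f \<le> ?n * (m * \<Gamma>)"
        using K by auto
      \<comment> \<open>The sign of \<open>K\<close> follows from its defining bound at a unit
        vector.\<close>
      moreover have "0 \<le> K"
        using order.trans[OF norm_ge_zero K[of "axis undefined 1"]] by (simp add: norm_axis_1)
      ultimately have "norm (dual_map v f) \<le> K * (?n * (m * \<Gamma>))"
        by (meson mult_left_mono order.trans)
      then have Qf: "(norm (dual_map v f))\<^sup>2 \<le> (K * (?n * (m * \<Gamma>)))\<^sup>2"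
        by (simp add: power_mono)
      have "\<bar>\<mu> v (j p) - \<mu> v (j q)\<bar> \<le> m * \<Gamma>"
        using gamma_chain_diff_le(2)[OF chain _ \<open>q \<le> L\<close>] P[OF p(1)] mult_right_mono[OF _ \<open>\<Gamma> \<ge> 0\<close>]
        by (blast intro: order.trans)
      \<comment> \<open>The linear bound is weakened to a square so that it combines with the bound
        for the quadratic term.\<close>
      also have "\<dots> \<le> (m * \<Gamma>)\<^sup>2"
        using m by (simp add: self_le_power)
      finally have mu: "\<bar>\<mu> v (j p) - \<mu> v (j q)\<bar> \<le> (m * \<Gamma>)\<^sup>2" .
      have "dual_map v (real_vec (j p)) = dual_map v ?x + dual_map v f"
        by (simp add: p flip: matrix_vector_right_distrib)
      then have "\<mu> v (j p) - \<mu> v (j q) = 2 * (dual_map v ?x \<bullet> dual_map v f) + (norm (dual_map v f))\<^sup>2"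
        by (simp add: \<mu>_def power2_norm_eq_inner inner_add_left inner_add_right inner_commute)
      then have "2 * \<bar>dual_map v ?x \<bullet> dual_map v f\<bar> \<le> (m * \<Gamma>)\<^sup>2 + (K * (?n * (m * \<Gamma>)))\<^sup>2"
        using mu Qf by (smt (verit) zero_le_power2)
      also have "\<dots> = ?T"
        by (simp add: algebra_simps power_mult_distrib)
      finally show ?thesis
        by linarith
    qed
  qed (use z m in \<open>auto simp: F_def\<close>)
  then show ?thesis
    by (simp add: power_add power2_eq_square mult_ac)
qed

section \<open>Counting integer points in a cube\<close>

lemma length_le_of_box:
  fixes j :: "nat \<Rightarrow> int^'n"
  assumes "inj_on j {0..L}" and "R \<ge> 0"
    and R: "\<And>q i. q \<le> L \<Longrightarrow> \<bar>real_of_int (j q $ i - a $ i)\<bar> \<le> R"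
  shows "real L \<le> (2 * R + 1) ^ CARD('n)"
proof -
  define k where "k = \<lfloor>R\<rfloor>"
  have "k \<ge> 0"
    using \<open>R \<ge> 0\<close> by (simp add: k_def)
  \<comment> \<open>Translated members are viewed as plain functions, so that the cube becomes a
    \<open>PiE\<close> product of integer intervals with \<open>2 * k + 1\<close> elements
    each.\<close>
  let ?f = "\<lambda>q i. j q $ i - a $ i"
  have "inj_on ?f {0..L}"
    using assms(1) by (auto simp: inj_on_def fun_eq_iff vec_eq_iff)
  moreover have "?f ` {0..L} \<subseteq> PiE UNIV (\<lambda>_. {-k..k})"
  proof -
    have "\<bar>j q $ i - a $ i\<bar> \<le> k" if "q \<le> L" for q i
      using R[OF that, of i] unfolding k_def by (simp add: le_floor_iff)
    then show ?thesis
      by (force simp: abs_le_iff)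
  qed
  ultimately have "card {0..L} \<le> card (PiE (UNIV :: 'n set) (\<lambda>_. {-k..k}))"
    by (intro card_inj_on_le) (auto intro!: finite_PiE)
  then have "real L \<le> real (card (PiE (UNIV :: 'n set) (\<lambda>_. {-k..k})))"
    by simp
  also have "\<dots> = (2 * real_of_int k + 1) ^ CARD('n)"
    using \<open>k \<ge> 0\<close> by (simp add: card_PiE)
  also have "\<dots> \<le> (2 * R + 1) ^ CARD('n)"
    using \<open>k \<ge> 0\<close> by (intro power_mono) (auto simp: k_def)
  finally show ?thesis .
qed

section \<open>Induction on the affine dimension of a chain\<close>

text \<open>This is the dimension of the affine hull of \<open>j 0, ..., j L\<close>, measured as
  that of its direction space.\<close>

definition chain_dim :: "nat \<Rightarrow> (nat \<Rightarrow> int^'n) \<Rightarrow> nat" where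
  "chain_dim L j = dim ((\<lambda>p. real_vec (j p) - real_vec (j 0)) ` {0..L})"

text \<open>The last assumption makes every window of \<open>m\<close> steps span the full direction
  space of the chain. Hence at each \<open>q\<close> the functional is controlled by a window around
  \<open>q\<close>, with a bound in terms of \<open>m\<close> rather than \<open>L\<close>.\<close>

lemma chain_length_le_window:
  fixes v :: "'n::finite \<Rightarrow> real^'n"
  assumes "lattice_generators v"
  obtains D where "D \<ge> 1"
    "\<And>\<Gamma> L j m. \<lbrakk>\<Gamma> \<ge> 1; gamma_chain v \<Gamma> L j; 0 < m; m \<le> L;
        \<And>a. a + m \<le> L \<Longrightarrow> chain_dim L j \<le> chain_dim m (\<lambda>p. j (a + p))\<rbrakk>
      \<Longrightarrow> real L \<le> D * (real m * \<Gamma>) ^ ((CARD('n) + 2) * CARD('n))"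
proof -
  let ?n = "CARD('n)"
  obtain c where c: "c > 0" "\<And>x. c * norm x \<le> norm (dual_map v x)"
    using linear_inj_bounded_below_pos[OF matrix_vector_mul_linear inj_dual_map[OF assms]] by blast
  obtain K where K: "\<And>x. norm (dual_map v x) \<le> K * norm x"
    using linear_bounded_pos[OF matrix_vector_mul_linear, of "dual_matrix v"] by blast
  define X where "X = real ?n * fact ?n * (1 + (K * ?n)\<^sup>2)"
  have "X \<ge> 0"
    by (simp add: X_def)
  \<comment> \<open>The factor 2 adds the inner-product bounds at \<open>q\<close> and at 0, and
    \<open>c\<^sup>2\<close> comes from the lower bound on \<open>dual_map\<close>. The summand 1
    ensures \<open>R \<ge> 1\<close> below, so that \<open>2 * R + 1 \<le> 3 * R\<close>.\<close>
  define Y where "Y = 1 + 2 * X / c\<^sup>2"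
  have "Y \<ge> 1"
    using \<open>X \<ge> 0\<close> by (simp add: Y_def)
  have "real L \<le> (3 * Y) ^ ?n * (real m * \<Gamma>) ^ ((?n + 2) * ?n)"
    if "\<Gamma> \<ge> 1" and chain: "gamma_chain v \<Gamma> L j" and m: "0 < m" "m \<le> L"
      and dim: "\<And>a. a + m \<le> L \<Longrightarrow> chain_dim L j \<le> chain_dim m (\<lambda>p. j (a + p))"
    for \<Gamma> L j m
  proof -
    let ?d = "\<lambda>p q. real_vec (j p) - real_vec (j q)"
    define R where "R = Y * (real m * \<Gamma>) ^ (?n + 2)"
    have m\<Gamma>: "real m * \<Gamma> \<ge> 1"
      using m \<open>\<Gamma> \<ge> 1\<close> mult_mono[of 1 "real m" 1 \<Gamma>] by simp
    then have "R \<ge> 1"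
      using mult_mono[OF \<open>Y \<ge> 1\<close> one_le_power[OF m\<Gamma>, of "?n + 2"]] \<open>Y \<ge> 1\<close> unfolding R_def by simp
    have inner: "\<bar>dual_map v (real_vec (j q)) \<bullet> dual_map v z\<bar> \<le> X * (m * \<Gamma>) ^ (?n + 2) * norm z"
      if "q \<le> L" and z: "z \<in> span ((\<lambda>p. ?d p 0) ` {0..L})" for q z
    proof -
      \<comment> \<open>The window starts at \<open>q\<close> unless it would overrun the chain;
        then the last window is taken.\<close>
      define a where "a = min q (L - m)"
      have a: "a + m \<le> L" "a \<le> q" "q \<le> a + m"
        using m \<open>q \<le> L\<close> by (auto simp: a_def)
      let ?P = "{a..a + m}"
      have "(\<lambda>p. ?d p q) ` ?P \<subseteq> span ((\<lambda>p. ?d p 0) ` {0..L})"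
      proof (intro image_subsetI)
        fix p assume "p \<in> ?P"
        then have "?d p 0 - ?d q 0 \<in> span ((\<lambda>p. ?d p 0) ` {0..L})"
          using a \<open>q \<le> L\<close> by (intro span_diff span_base) auto
        then show "?d p q \<in> span ((\<lambda>p. ?d p 0) ` {0..L})"
          by simp
      qed
      moreover have "dim ((\<lambda>p. ?d p 0) ` {0..L}) \<le> dim ((\<lambda>p. ?d p q) ` ?P)"
      proof -
        \<comment> \<open>The base point moves from the start \<open>a\<close> of the window to its
          member \<open>q\<close>.\<close>
        have "(\<lambda>p. ?d (a + p) a) ` {0..m} \<subseteq> span ((\<lambda>p. ?d p q) ` ?P)"
        proof (intro image_subsetI)
          fix p assume "p \<in> {0..m}"
          then have "?d (a + p) q - ?d a q \<in> span ((\<lambda>p. ?d p q) ` ?P)"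
            by (intro span_diff span_base) auto
          then show "?d (a + p) a \<in> span ((\<lambda>p. ?d p q) ` ?P)"
            by simp
        qed
        then have "dim ((\<lambda>p. ?d (a + p) a) ` {0..m}) \<le> dim ((\<lambda>p. ?d p q) ` ?P)"
          by (rule dim_mono)
        then show ?thesis
          using dim[OF a(1)] by (simp add: chain_dim_def)
      qed
      \<comment> \<open>One span lies inside the other and has at least its dimension, so they
        agree.\<close>
      ultimately have "span ((\<lambda>p. ?d p q) ` ?P) = span ((\<lambda>p. ?d p 0) ` {0..L})"
        by (intro subspace_dim_equal) (auto intro: span_minimal[THEN subsetD])
      then show ?thesis
        unfolding X_def using z a \<open>q \<le> L\<close> \<open>\<Gamma> \<ge> 1\<close> m\<Gamma>
        by (intro chain_inner_le[OF chain \<open>q \<le> L\<close>, where P = ?P and m = "real m"] K) auto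
    qed
    have "norm (?d q 0) \<le> R" if "q \<le> L" for q
    proof -
      define z where "z = ?d q 0"
      have z: "z \<in> span ((\<lambda>p. ?d p 0) ` {0..L})"
        unfolding z_def using that by (intro span_base) auto
      have "c\<^sup>2 * (norm z)\<^sup>2 \<le> (norm (dual_map v z))\<^sup>2"
        using power_mono[OF c(2)[of z], of 2] c(1) by (simp add: power_mult_distrib)
      also have "\<dots> = dual_map v (real_vec (j q)) \<bullet> dual_map v z - dual_map v (real_vec (j 0)) \<bullet> dual_map v z"
        unfolding power2_norm_eq_inner
        by (simp add: z_def matrix_vector_mult_diff_distrib inner_diff_left)
      also have "\<dots> \<le> 2 * (X * (m * \<Gamma>) ^ (?n + 2)) * norm z"
        using inner[OF that z] inner[OF _ z, of 0] by linarith
      finally have "c\<^sup>2 * norm z * norm z \<le> 2 * (X * (m * \<Gamma>) ^ (?n + 2)) * norm z"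
        by (simp add: power2_eq_square mult.assoc)
      \<comment> \<open>The left side is quadratic in \<open>norm z\<close>, the right side only
        linear: one factor cancels unless \<open>z = 0\<close>.\<close>
      then have "c\<^sup>2 * norm z \<le> 2 * (X * (m * \<Gamma>) ^ (?n + 2))"
      proof (cases "z = 0")
        case True
        have "0 \<le> X * (m * \<Gamma>) ^ (?n + 2)"
          using \<open>X \<ge> 0\<close> m\<Gamma> by (intro mult_nonneg_nonneg[OF _ zero_le_power]) linarith+
        with True show ?thesis
          by simp
      qed (use mult_right_le_imp_le in fastforce)
      then have "norm z \<le> 2 * X / c\<^sup>2 * (m * \<Gamma>) ^ (?n + 2)"
        using c(1) by (simp add: pos_le_divide_eq mult_ac)
      also have "\<dots> \<le> R"
        unfolding R_def Y_def using m\<Gamma> by (intro mult_right_mono) auto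
      finally show ?thesis
        by (simp add: z_def)
    qed
    then have "\<bar>real_of_int (j q $ i - j 0 $ i)\<bar> \<le> R" if "q \<le> L" for q i
      using order.trans[OF component_le_norm_cart] that by (fastforce simp: real_vec_def)
    then have "real L \<le> (2 * R + 1) ^ ?n"
      using chain \<open>R \<ge> 1\<close> by (intro length_le_of_box) (auto simp: gamma_chain_def)
    also have "\<dots> \<le> (3 * R) ^ ?n"
      using \<open>R \<ge> 1\<close> by (intro power_mono) auto
    also have "\<dots> = (3 * Y) ^ ?n * (real m * \<Gamma>) ^ ((?n + 2) * ?n)"
      by (simp only: R_def power_mult_distrib power_mult mult.assoc)
    finally show ?thesis .
  qed
  moreover have "(3 * Y) ^ ?n \<ge> 1"
    using \<open>Y \<ge> 1\<close> by (intro one_le_power) simp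
  ultimately show ?thesis
    using that by blast
qed

text \<open>The exponent \<open>e\<close> is chosen before \<open>v\<close>, so it depends only on
  \<open>g\<close> and the ambient dimension; the constant \<open>C\<close> may depend on the
  lattice.\<close>

lemma chain_length_le_of_dim:
  "\<exists>e::nat. \<forall>v :: 'n::finite \<Rightarrow> real^'n. lattice_generators v \<longrightarrow>
     (\<exists>C\<ge>0. \<forall>\<Gamma>\<ge>1. \<forall>L j. gamma_chain v \<Gamma> L j \<longrightarrow> chain_dim L j \<le> g \<longrightarrow> real L \<le> C * \<Gamma> ^ e)"
proof (induction g)
  case 0
  \<comment> \<open>In dimension 0 all members coincide, which distinctness permits only for a
    single point.\<close>
  have "L = 0" if chain: "gamma_chain v \<Gamma> L j" and dim: "chain_dim L j \<le> 0"
    for v :: "'n \<Rightarrow> real^'n" and \<Gamma> L j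
  proof -
    have "(\<lambda>p. real_vec (j p) - real_vec (j 0)) ` {0..L} \<subseteq> {0}"
      using dim by (simp only: chain_dim_def le_zero_eq dim_eq_0)
    moreover have "real_vec (j L) - real_vec (j 0) \<in> (\<lambda>p. real_vec (j p) - real_vec (j 0)) ` {0..L}"
      by (rule imageI) simp
    ultimately have "real_vec (j L) - real_vec (j 0) = 0"
      by blast
    then have "j L = j 0"
      by (simp add: real_vec_def vec_eq_iff)
    then show ?thesis
      using chain by (auto simp: gamma_chain_def inj_on_def)
  qed
  then show ?case
    by (intro exI[of _ 0]) (auto intro!: exI[of _ 0])
next
  case (Suc g)
  then obtain e where e: "\<And>v :: 'n \<Rightarrow> real^'n. lattice_generators v \<Longrightarrow>
     \<exists>C\<ge>0. \<forall>\<Gamma>\<ge>1. \<forall>L j. gamma_chain v \<Gamma> L j \<longrightarrow> chain_dim L j \<le> g \<longrightarrow> real L \<le> C * \<Gamma> ^ e"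
    by blast
  define N where "N = (CARD('n) + 2) * CARD('n)"
  have "\<exists>C\<ge>0. \<forall>\<Gamma>\<ge>1. \<forall>L j. gamma_chain v \<Gamma> L j \<longrightarrow> chain_dim L j \<le> Suc g \<longrightarrow>
      real L \<le> C * \<Gamma> ^ (e + (e + 1) * N)"
    if v: "lattice_generators v" for v :: "'n \<Rightarrow> real^'n"
  proof -
    obtain C where "C \<ge> 0" and C: "\<And>\<Gamma> L j. \<Gamma> \<ge> 1 \<Longrightarrow> gamma_chain v \<Gamma> L j \<Longrightarrow> chain_dim L j \<le> g \<Longrightarrow>
        real L \<le> C * \<Gamma> ^ e"
      using e[OF v] by blast
    obtain D where "D \<ge> 1" and D: "\<And>\<Gamma> L j m. \<lbrakk>\<Gamma> \<ge> 1; gamma_chain v \<Gamma> L j; 0 < m; m \<le> L;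
        \<And>a. a + m \<le> L \<Longrightarrow> chain_dim L j \<le> chain_dim m (\<lambda>p. j (a + p))\<rbrakk>
      \<Longrightarrow> real L \<le> D * (real m * \<Gamma>) ^ N"
      using chain_length_le_window[OF v] unfolding N_def by blast
    \<comment> \<open>Constant and exponent dominate both cases at once:
      \<open>C * \<Gamma> ^ e\<close> for \<open>L < m\<close>, and
      \<open>D * ((C + 1) * \<Gamma> ^ (e + 1)) ^ N\<close> otherwise.\<close>
    have "real L \<le> (C + D * (C + 1) ^ N) * \<Gamma> ^ (e + (e + 1) * N)"
      if "\<Gamma> \<ge> 1" and chain: "gamma_chain v \<Gamma> L j" and dim: "chain_dim L j \<le> Suc g" for \<Gamma> L j
    proof -
      \<comment> \<open>The least natural number strictly above the length bound for dimension
        \<open>g\<close>.\<close>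
      define m where "m = nat \<lfloor>C * \<Gamma> ^ e\<rfloor> + 1"
      have "C * \<Gamma> ^ e \<ge> 0"
        using \<open>C \<ge> 0\<close> \<open>\<Gamma> \<ge> 1\<close> by simp
      then have m: "C * \<Gamma> ^ e < real m" "real m \<le> C * \<Gamma> ^ e + 1"
        unfolding m_def by linarith+
      have low: "C * \<Gamma> ^ e \<le> (C + D * (C + 1) ^ N) * \<Gamma> ^ (e + (e + 1) * N)"
        using \<open>C \<ge> 0\<close> \<open>D \<ge> 1\<close> \<open>\<Gamma> \<ge> 1\<close> by (intro mult_mono power_increasing) auto
      show ?thesis
      proof (cases "m \<le> L")
        case False
        then have "real L \<le> C * \<Gamma> ^ e"
          using \<open>C * \<Gamma> ^ e \<ge> 0\<close> unfolding m_def by linarith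
        then show ?thesis
          using low by linarith
      next
        case True
        \<comment> \<open>By the induction hypothesis in contrapositive form, a window this long has
          dimension at least \<open>Suc g\<close>, which is all the chain can have.\<close>
        have "chain_dim L j \<le> chain_dim m (\<lambda>p. j (a + p))" if "a + m \<le> L" for a
          using C[OF \<open>\<Gamma> \<ge> 1\<close> gamma_chain_subchain[OF chain that]] m(1) dim by linarith
        then have "real L \<le> D * (real m * \<Gamma>) ^ N"
          using True \<open>\<Gamma> \<ge> 1\<close> chain by (intro D) (auto simp: m_def)
        also have "\<dots> \<le> D * ((C + 1) * \<Gamma> ^ (e + 1)) ^ N"
        proof -
          have "real m \<le> (C + 1) * \<Gamma> ^ e"
            using m(2) one_le_power[OF \<open>\<Gamma> \<ge> 1\<close>, of e] by (simp add: algebra_simps)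
          then have "real m * \<Gamma> \<le> (C + 1) * \<Gamma> ^ e * \<Gamma>"
            using \<open>\<Gamma> \<ge> 1\<close> by (intro mult_right_mono) auto
          then show ?thesis
            using \<open>D \<ge> 1\<close> \<open>\<Gamma> \<ge> 1\<close> by (intro mult_left_mono power_mono) (auto simp: mult_ac)
        qed
        also have "\<dots> = D * (C + 1) ^ N * \<Gamma> ^ ((e + 1) * N)"
          by (simp only: power_mult_distrib power_mult mult.assoc)
        also have "\<dots> \<le> (C + D * (C + 1) ^ N) * \<Gamma> ^ (e + (e + 1) * N)"
          using \<open>C \<ge> 0\<close> \<open>D \<ge> 1\<close> \<open>\<Gamma> \<ge> 1\<close> by (intro mult_mono power_increasing) auto
        finally show ?thesis .
      qed
    qed
    moreover have "C + D * (C + 1) ^ N \<ge> 0"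
      using \<open>C \<ge> 0\<close> \<open>D \<ge> 1\<close> by simp
    ultimately show ?thesis
      by blast
  qed
  then show ?case
    by blast
qed

theorem proposition2p5:
  "\<exists>C1::real. C1 > 0 \<and>
     (\<forall>v :: 'n::finite \<Rightarrow> real ^ 'n. lattice_generators v \<longrightarrow>
        (\<exists>C2::real. C2 > 0 \<and>
           (\<forall>\<Gamma>::real. \<Gamma> \<ge> 2 \<longrightarrow>
              (\<forall>(L::nat) (j :: nat \<Rightarrow> int ^ 'n). gamma_chain v \<Gamma> L j \<longrightarrow>
                 real L \<le> C2 * \<Gamma> powr C1))))"
proof -
  \<comment> \<open>With \<open>g\<close> equal to the ambient dimension, the restriction on
    \<open>chain_dim\<close> holds for every chain.\<close>
  obtain e where e: "\<And>v :: 'n \<Rightarrow> real^'n. lattice_generators v \<Longrightarrow>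
     \<exists>C\<ge>0. \<forall>\<Gamma>\<ge>1. \<forall>L j. gamma_chain v \<Gamma> L j \<longrightarrow> chain_dim L j \<le> CARD('n) \<longrightarrow> real L \<le> C * \<Gamma> ^ e"
    using chain_length_le_of_dim[where 'n = 'n] by blast
  \<comment> \<open>\<open>Suc e\<close> and, below, \<open>C + 1\<close> replace \<open>e\<close>
    and \<open>C\<close>, which may be 0, to make both constants positive.\<close>
  have "\<exists>C2>0. \<forall>\<Gamma>\<ge>2. \<forall>L j. gamma_chain v \<Gamma> L j \<longrightarrow> real L \<le> C2 * \<Gamma> powr real (Suc e)"
    if v: "lattice_generators v" for v :: "'n \<Rightarrow> real^'n"
  proof -
    obtain C where "C \<ge> 0" and C: "\<And>\<Gamma> L j. \<Gamma> \<ge> 1 \<Longrightarrow> gamma_chain v \<Gamma> L j \<Longrightarrow>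
        chain_dim L j \<le> CARD('n) \<Longrightarrow> real L \<le> C * \<Gamma> ^ e"
      using e[OF v] by blast
    have "real L \<le> (C + 1) * \<Gamma> powr real (Suc e)" if "\<Gamma> \<ge> 2" "gamma_chain v \<Gamma> L j" for \<Gamma> L j
    proof -
      have "real L \<le> C * \<Gamma> ^ e"
        using that C unfolding chain_dim_def by (simp add: dim_subset_UNIV_cart)
      also have "\<dots> \<le> (C + 1) * \<Gamma> ^ Suc e"
        using \<open>C \<ge> 0\<close> \<open>\<Gamma> \<ge> 2\<close> by (intro mult_mono power_increasing) auto
      finally show ?thesis
        using \<open>\<Gamma> \<ge> 2\<close> by (simp only: powr_realpow)
    qed
    then show ?thesis
      using \<open>C \<ge> 0\<close> by (intro exI[of _ "C + 1"]) auto
  qed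
  then show ?thesis
    by (intro exI[of _ "real (Suc e)"]) auto
qed

end
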